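(* Let $\{X_\alpha\}_{\alpha\in A}$ be any family of topological spaces. If every $X_\alpha$ is quasi $\kappa$-metrizable, then the product $\prod_{\alpha\in A}X_\alpha$ (with the Tychonoff product topology) is quasi $\kappa$-metrizable. If every $X_\alpha$ is regularly quasi $\kappa$-metrizable, then $\prod_{\alpha\in A}X_\alpha$ is regularly quasi $\kappa$-metrizable.
   Context: All topological spaces are assumed Tychonoff. A set $C\subset X$ is regularly closed if it is the closure of an open set (equivalently $C=\overline{\mathrm{Int}\,C}$). A quasi $\kappa$-metric on a space $X$ is a non-negative real-valued function $\rho(x,C)$ of a point $x\in X$ and a regularly closed set $C\subset X$ such that: K1)$^*$ for any regularly closed $C$ there is a dense open subset $V$ of $X\setminus C$ such that $\rho(x,C)>0$ iff $x\in V$; K2) if $C\subset C'$, then $\rho(x,C')\le\rho(x,C)$ for every $x\in X$; K3) for every $C$, $\rho(x,C)$ is a continuous function of $x$; K4) $\rho(x,\overline{\bigcup_\alpha C_\alpha})=\inf_\alpha\rho(x,C_\alpha)$ for every $x\in X$ and every increasing transfinite (i.e. well-ordered by index) family $\{C_\alpha\}$ of regularly closed sets in $X$. It is regular if moreover: K5) $\rho(x,C)\le\rho(x,C')+\overline\rho(C',C)$ for any $x\in X$ and any regularly closed $C,C'$, where $\overline\rho(C',C)=\sup\{\rho(y,C):y\in C'\}$. A space is (regularly) quasi $\kappa$-metrizable if it admits a (regular) quasi $\kappa$-metric. *)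

theory Defs
  imports "HOL-Analysis.Analysis"
begin

definition tychonoff_space :: "'a topology \<Rightarrow> bool" where
  "tychonoff_space X \<longleftrightarrow> completely_regular_space X \<and> Hausdorff_space X"

definition regularly_closedin :: "'a topology \<Rightarrow> 'a set \<Rightarrow> bool" where
  "regularly_closedin X C \<longleftrightarrow> (\<exists>U. openin X U \<and> C = X closure_of U)"

definition increasing_transfinite_family ::
    "'a topology \<Rightarrow> 'j set \<Rightarrow> 'j rel \<Rightarrow> ('j \<Rightarrow> 'a set) \<Rightarrow> bool" where
  "increasing_transfinite_family X J r C \<longleftrightarrow>
     J \<noteq> {} \<and> well_order_on J r \<and>
     (\<forall>j\<in>J. regularly_closedin X (C j)) \<and>
     (\<forall>i j. (i, j) \<in> r \<longrightarrow> C i \<subseteq> C j)"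

text \<open>
  A quasi kappa-metric on \<open>X\<close> is a function \<open>\<rho>\<close> of which only the values \<open>\<rho> x C\<close> with
  \<open>x\<close> a point of \<open>X\<close> and \<open>C\<close> regularly closed in \<open>X\<close> are relevant. The five conjuncts after
  the binders are non-negativity, K1*, K2, K3 and K4.

  In K4 the transfinite families are indexed by well-ordered sets of elements of type
  \<^typ>\<open>'a set\<close>, since a definition cannot quantify over types. No family is lost: see
  \<open>quasi_kappa_metric_family\<close> below.
\<close>

definition quasi_kappa_metric :: "'a topology \<Rightarrow> ('a \<Rightarrow> 'a set \<Rightarrow> real) \<Rightarrow> bool" where
  "quasi_kappa_metric X \<rho> \<longleftrightarrow>
     (\<forall>C. regularly_closedin X C \<longrightarrow> (\<forall>x\<in>topspace X. 0 \<le> \<rho> x C)) \<and>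
     (\<forall>C. regularly_closedin X C \<longrightarrow>
        (\<exists>V. openin (subtopology X (topspace X - C)) V \<and>
             subtopology X (topspace X - C) closure_of V = topspace X - C \<and>
             (\<forall>x\<in>topspace X. 0 < \<rho> x C \<longleftrightarrow> x \<in> V))) \<and>
     (\<forall>C C'. regularly_closedin X C \<and> regularly_closedin X C' \<and> C \<subseteq> C' \<longrightarrow>
        (\<forall>x\<in>topspace X. \<rho> x C' \<le> \<rho> x C)) \<and>
     (\<forall>C. regularly_closedin X C \<longrightarrow> continuous_map X euclideanreal (\<lambda>x. \<rho> x C)) \<and>
     (\<forall>(J :: 'a set set) r C. increasing_transfinite_family X J r C \<longrightarrow>
        (\<forall>x\<in>topspace X. \<rho> x (X closure_of (\<Union>j\<in>J. C j)) = (INF j\<in>J. \<rho> x (C j))))"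

text \<open>
  The supremum may be infinite, and is \<open>0\<close> for empty \<open>C'\<close>; hence it is taken in
  \<^typ>\<open>ennreal\<close>. (For empty \<open>C'\<close>, K5 is then an instance of K2.)
\<close>

definition sup_kappa :: "('a \<Rightarrow> 'a set \<Rightarrow> real) \<Rightarrow> 'a set \<Rightarrow> 'a set \<Rightarrow> ennreal" where
  "sup_kappa \<rho> C' C = (SUP y\<in>C'. ennreal (\<rho> y C))"

definition regular_quasi_kappa_metric :: "'a topology \<Rightarrow> ('a \<Rightarrow> 'a set \<Rightarrow> real) \<Rightarrow> bool" where
  "regular_quasi_kappa_metric X \<rho> \<longleftrightarrow>
     quasi_kappa_metric X \<rho> \<and>
     (\<forall>C C'. regularly_closedin X C \<and> regularly_closedin X C' \<longrightarrow>
        (\<forall>x\<in>topspace X. ennreal (\<rho> x C) \<le> ennreal (\<rho> x C') + sup_kappa \<rho> C' C))"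

definition quasi_kappa_metrizable_space :: "'a topology \<Rightarrow> bool" where
  "quasi_kappa_metrizable_space X \<longleftrightarrow> tychonoff_space X \<and> (\<exists>\<rho>. quasi_kappa_metric X \<rho>)"

definition regularly_quasi_kappa_metrizable_space :: "'a topology \<Rightarrow> bool" where
  "regularly_quasi_kappa_metrizable_space X \<longleftrightarrow>
     tychonoff_space X \<and> (\<exists>\<rho>. regular_quasi_kappa_metric X \<rho>)"

lemma increasing_transfinite_family_image:
  assumes "increasing_transfinite_family X J r C"
  shows "increasing_transfinite_family X (C ` J) {(S, T). S \<in> C ` J \<and> T \<in> C ` J \<and> S \<subseteq> T} id"
proof -
  let ?r = "{(S, T). S \<in> C ` J \<and> T \<in> C ` J \<and> S \<subseteq> T}"
  have J: "J \<noteq> {}" and wo: "well_order_on J r"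
    and rc: "\<And>j. j \<in> J \<Longrightarrow> regularly_closedin X (C j)"
    and mono: "\<And>i j. (i, j) \<in> r \<Longrightarrow> C i \<subseteq> C j"
    using assms by (auto simp: increasing_transfinite_family_def)
  have comparable: "(i, j) \<in> r \<or> (j, i) \<in> r" if "i \<in> J" "j \<in> J" for i j
  proof -
    have "total_on J r" and "refl_on J r"
      using wo by (simp_all add: order_on_defs)
    then show ?thesis using that by (cases "i = j") (auto simp: total_on_def refl_on_def)
  qed
  have "wf (?r - Id)"
  proof (rule wfI_min)
    fix S :: "'a set" and Q
    assume "S \<in> Q"
    show "\<exists>T\<in>Q. \<forall>U. (U, T) \<in> ?r - Id \<longrightarrow> U \<notin> Q"
    proof (cases "Q \<inter> C ` J = {}")
      case True
      then show ?thesis using \<open>S \<in> Q\<close> by blast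
    next
      case False
      then obtain i where i: "i \<in> {j \<in> J. C j \<in> Q}" by blast
      have wf: "wf (r - Id)" using wo by (simp add: well_order_on_def)
      obtain m where m: "m \<in> {j \<in> J. C j \<in> Q}"
        and min: "\<And>k. (k, m) \<in> r - Id \<Longrightarrow> k \<notin> {j \<in> J. C j \<in> Q}"
        using wf[unfolded wf_eq_minimal, rule_format, OF i] by auto
      have least: "C m \<subseteq> C k" if "k \<in> J" "C k \<in> Q" for k
      proof (cases "(m, k) \<in> r")
        case True
        then show ?thesis by (rule mono)
      next
        case False
        then have "(k, m) \<in> r" using comparable[of m k] m that by simp
        then have "k = m" using min[of k] that by auto
        then show ?thesis by simp
      qed
      have "\<forall>U. (U, C m) \<in> ?r - Id \<longrightarrow> U \<notin> Q"
        using least by auto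
      moreover have "C m \<in> Q" using m by simp
      ultimately show ?thesis by (rule bexI)
    qed
  qed
  moreover have "total_on (C ` J) ?r"
    unfolding total_on_def
  proof (intro ballI impI)
    fix S T assume "S \<in> C ` J" "T \<in> C ` J"
    then obtain i j where ij: "i \<in> J" "j \<in> J" "S = C i" "T = C j" by auto
    then have "S \<subseteq> T \<or> T \<subseteq> S" using comparable[of i j] mono[of i j] mono[of j i] by auto
    then show "(S, T) \<in> ?r \<or> (T, S) \<in> ?r" using ij by simp
  qed
  moreover have "refl_on (C ` J) ?r" by (simp add: refl_on_def)
  moreover have "trans ?r" by (rule transI) auto
  moreover have "antisym ?r" by (rule antisymI) auto
  moreover have "?r \<subseteq> C ` J \<times> C ` J" by auto
  ultimately have "well_order_on (C ` J) ?r"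
    by (simp add: order_on_defs)
  then show ?thesis
    using J rc by (simp add: increasing_transfinite_family_def)
qed

lemma quasi_kappa_metric_family:
  fixes J :: "'j set"
  assumes "quasi_kappa_metric X \<rho>" and "increasing_transfinite_family X J r C"
    and "x \<in> topspace X"
  shows "\<rho> x (X closure_of (\<Union>j\<in>J. C j)) = (INF j\<in>J. \<rho> x (C j))"
proof -
  have "\<rho> x (X closure_of (\<Union>S\<in>C ` J. id S)) = (INF S\<in>C ` J. \<rho> x (id S))"
    using assms(1)[unfolded quasi_kappa_metric_def, THEN conjunct2, THEN conjunct2,
        THEN conjunct2, THEN conjunct2, rule_format,
        OF increasing_transfinite_family_image[OF assms(2)] assms(3)] .
  then show ?thesis by (simp add: image_image)
qed

end

theory Submission
  imports Defs
begin

text \<open>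
  The value at \<open>(x, C)\<close> of the quasi kappa-metric on the product is the supremum of the \<open>c > 0\<close> (or \<open>0\<close>, if
  there are none) admitting a finite set \<open>B\<close> of coordinates with \<open>c \<le> 1 / (card B + 1)\<close> and regularly closed sets \<open>D a\<close>
  in the factors with \<open>\<rho> a (x a) (D a) \<ge> c\<close> for \<open>a \<in> B\<close>, such that the cylinders over the \<open>D a\<close>
  cover \<open>C\<close>. Lower semicontinuity is immediate. Upper semicontinuity and K4 both follow from the
  closure of the set of such witnesses under ultrafilter limits: the bound on \<open>card B\<close> makes the
  limit of the sets \<open>B\<close> finite, the limits of the \<open>D a\<close> are controlled by K4 in the factors
  (extended from chains to directed families), and covering passes to the limit because a box
  contained in a union of cylinders over distinct coordinates is contained in one of them.
  For K5, a witness for \<open>(x, C)\<close> gives one for \<open>(x, C')\<close> by replacing \<open>D a\<close> with the closure of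
  the interior of \<open>{z. \<rho> a z (D a) \<le> s}\<close>, where \<open>s\<close> is the supremum over \<open>C'\<close>.
\<close>

section \<open>Regularly closed sets\<close>

lemma regularly_closedin_closedin: "regularly_closedin X C \<Longrightarrow> closedin X C"
  by (auto simp: regularly_closedin_def)

lemma regularly_closedin_subset: "regularly_closedin X C \<Longrightarrow> C \<subseteq> topspace X"
  by (simp add: closedin_subset regularly_closedin_closedin)

lemma regularly_closedin_closure_of: "openin X U \<Longrightarrow> regularly_closedin X (X closure_of U)"
  by (auto simp: regularly_closedin_def)

lemma regularly_closedin_empty: "regularly_closedin X {}"
  unfolding regularly_closedin_def by (rule exI[of _ "{}"]) simp

lemma regularly_closedin_Un:
  assumes "regularly_closedin X C" "regularly_closedin X D"
  shows "regularly_closedin X (C \<union> D)"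
  using assms unfolding regularly_closedin_def by (metis closure_of_Un openin_Un)

lemma closure_of_UN_closure_of:
  "X closure_of (\<Union>i\<in>I. X closure_of U i) = X closure_of (\<Union>i\<in>I. U i)"
proof (rule antisym)
  have "(\<Union>i\<in>I. X closure_of U i) \<subseteq> X closure_of (\<Union>i\<in>I. U i)"
    by (intro UN_least closure_of_mono) auto
  then show "X closure_of (\<Union>i\<in>I. X closure_of U i) \<subseteq> X closure_of (\<Union>i\<in>I. U i)"
    by (simp add: closure_of_minimal)
  \<comment> \<open>\<open>U i\<close> need not lie in \<open>topspace X\<close>, and only its trace
    there is contained in its closure. Passing to the trace leaves the closure of the union
    unchanged.\<close>
  have "X closure_of (topspace X \<inter> (\<Union>i\<in>I. U i)) \<subseteq> X closure_of (\<Union>i\<in>I. X closure_of U i)"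
    using closure_of_subset_Int[of X] by (intro closure_of_mono) blast
  then show "X closure_of (\<Union>i\<in>I. U i) \<subseteq> X closure_of (\<Union>i\<in>I. X closure_of U i)"
    by (simp flip: closure_of_restrict)
qed

text \<open>Choosing generating open sets simultaneously exhibits the closure of a union of
  regularly closed sets as the closure of one open set.\<close>

lemma regularly_closedin_Union_repr:
  assumes "\<And>C. C \<in> \<C> \<Longrightarrow> regularly_closedin X C"
  shows "\<exists>U. (\<forall>C\<in>\<C>. openin X (U C) \<and> C = X closure_of U C) \<and>
    X closure_of (\<Union>\<C>) = X closure_of (\<Union>C\<in>\<C>. U C)"
proof -
  obtain U where U: "\<And>C. C \<in> \<C> \<Longrightarrow> openin X (U C) \<and> C = X closure_of U C"
    using assms unfolding regularly_closedin_def by metis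
  have "\<Union>\<C> = (\<Union>C\<in>\<C>. X closure_of U C)" using U by auto
  then show ?thesis using U by (metis closure_of_UN_closure_of)
qed

lemma regularly_closedin_closure_of_Union:
  assumes "\<And>C. C \<in> \<C> \<Longrightarrow> regularly_closedin X C"
  shows "regularly_closedin X (X closure_of (\<Union>\<C>))"
  using regularly_closedin_Union_repr[OF assms, of \<C>]
  by (metis (no_types, lifting) openin_Union imageE regularly_closedin_closure_of)

section \<open>Well-ordered cofinal subfamilies of chains\<close>

text \<open>K4 speaks only of well-ordered families, so a chain has to be thinned. Well-order it
  arbitrarily and keep the members that strictly contain all their predecessors: on these, inclusion
  implies the chosen order and is therefore well-founded.\<close>

lemma chain_cofinal_well_ordered:
  fixes L :: "'a set set"
  assumes chain: "\<And>S T. S \<in> L \<Longrightarrow> T \<in> L \<Longrightarrow> S \<subseteq> T \<or> T \<subseteq> S"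
  obtains W where "W \<subseteq> L" "well_order_on W {(S, T). S \<in> W \<and> T \<in> W \<and> S \<subseteq> T}"
    "\<And>S. S \<in> L \<Longrightarrow> \<exists>T\<in>W. S \<subseteq> T"
proof -
  obtain r where r: "well_order_on L r" using well_order_on by blast
  define W where "W = {a \<in> L. \<forall>b\<in>L. (b, a) \<in> r \<and> b \<noteq> a \<longrightarrow> b \<subset> a}"
  have wf: "wf (r - Id)" and tot: "total_on L r" and refl: "refl_on L r" and tr: "trans r"
    using r by (auto simp: order_on_defs)
  let ?s = "{(S, T). S \<in> W \<and> T \<in> W \<and> S \<subseteq> T}"
  have r_iff: "(S, T) \<in> r" if "S \<in> W" "T \<in> W" "S \<subseteq> T" for S T
  proof (rule ccontr)
    assume n: "(S, T) \<notin> r"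
    have "S \<in> L" "T \<in> L" using that by (auto simp: W_def)
    with n refl tot have "(T, S) \<in> r" "T \<noteq> S"
      unfolding refl_on_def total_on_def by metis+
    with \<open>S \<in> W\<close> \<open>T \<in> L\<close> have "T \<subset> S" by (auto simp: W_def)
    with that show False by blast
  qed
  have "wf (?s - Id)"
    by (rule wf_subset[OF wf]) (use r_iff in auto)
  moreover have "total_on W ?s" using chain by (auto simp: total_on_def W_def)
  moreover have "refl_on W ?s" by (simp add: refl_on_def)
  moreover have "trans ?s" by (rule transI) auto
  moreover have "antisym ?s" by (rule antisymI) auto
  moreover have "?s \<subseteq> W \<times> W" by auto
  ultimately have "well_order_on W ?s" by (simp add: order_on_defs)
  moreover have "\<exists>T\<in>W. S \<subseteq> T" if S: "S \<in> L" for S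
  proof -
    have "S \<in> {b \<in> L. S \<subseteq> b}" using S by auto
    \<comment> \<open>The first \<open>b\<close> containing \<open>S\<close> is kept: no predecessor
      \<open>c\<close> contains \<open>S\<close>, so
      \<open>c \<subset> S \<subseteq> b\<close>.\<close>
    then obtain b where b: "b \<in> {b \<in> L. S \<subseteq> b}"
      and min: "\<And>c. (c, b) \<in> r - Id \<Longrightarrow> c \<notin> {b \<in> L. S \<subseteq> b}"
      using wf[unfolded wf_eq_minimal, rule_format, of S "{b \<in> L. S \<subseteq> b}"] by metis
    have "c \<subset> b" if "c \<in> L" "(c, b) \<in> r" "c \<noteq> b" for c
    proof -
      have "\<not> S \<subseteq> c" using min[of c] that by auto
      then have "c \<subset> S" using chain[OF S \<open>c \<in> L\<close>] by auto
      then show ?thesis using b by auto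
    qed
    then have "b \<in> W" using b by (auto simp: W_def)
    then show ?thesis using b by auto
  qed
  ultimately show ?thesis using that[of W] by (auto simp: W_def)
qed

section \<open>Consequences of the axioms; K4 for chains and ideals\<close>

lemma quasi_kappa_metric_nonneg:
  "quasi_kappa_metric X \<rho> \<Longrightarrow> regularly_closedin X C \<Longrightarrow> x \<in> topspace X \<Longrightarrow> 0 \<le> \<rho> x C"
  by (simp add: quasi_kappa_metric_def)

lemma quasi_kappa_metric_dense:
  assumes "quasi_kappa_metric X \<rho>" "regularly_closedin X C"
  obtains V where "openin (subtopology X (topspace X - C)) V"
    "subtopology X (topspace X - C) closure_of V = topspace X - C"
    "\<And>x. x \<in> topspace X \<Longrightarrow> 0 < \<rho> x C \<longleftrightarrow> x \<in> V"
  using assms unfolding quasi_kappa_metric_def by metis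

lemma quasi_kappa_metric_antimono:
  "quasi_kappa_metric X \<rho> \<Longrightarrow> regularly_closedin X C \<Longrightarrow> regularly_closedin X C' \<Longrightarrow>
   C \<subseteq> C' \<Longrightarrow> x \<in> topspace X \<Longrightarrow> \<rho> x C' \<le> \<rho> x C"
  by (simp add: quasi_kappa_metric_def)

lemma quasi_kappa_metric_continuous:
  "quasi_kappa_metric X \<rho> \<Longrightarrow> regularly_closedin X C \<Longrightarrow>
   continuous_map X euclideanreal (\<lambda>x. \<rho> x C)"
  by (simp add: quasi_kappa_metric_def)

lemma quasi_kappa_metric_notin:
  assumes "quasi_kappa_metric X \<rho>" "regularly_closedin X C" "x \<in> topspace X" "0 < \<rho> x C"
  shows "x \<notin> C"
  using quasi_kappa_metric_dense[OF assms(1,2)] assms(3,4)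
  by (metis DiffD2 openin_imp_subset subsetD topspace_subtopology_subset Diff_subset)

text \<open>The form in which the density part of K1* is used: \<open>P\<close> lies in the
  complement of \<open>C\<close>, hence in the closure of the positivity set \<open>V\<close>, and
  so meets \<open>V\<close>.\<close>

lemma quasi_kappa_metric_meets:
  assumes "quasi_kappa_metric X \<rho>" "regularly_closedin X C"
    and P: "openin X P" "P \<noteq> {}" "P \<inter> C = {}"
  obtains x where "x \<in> P" "0 < \<rho> x C"
proof -
  obtain V where V: "subtopology X (topspace X - C) closure_of V = topspace X - C"
    "\<And>x. x \<in> topspace X \<Longrightarrow> 0 < \<rho> x C \<longleftrightarrow> x \<in> V"
    using quasi_kappa_metric_dense[OF assms(1,2)] by metis
  have "P \<subseteq> topspace X - C" using P openin_subset by fastforce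
  then have "P \<subseteq> X closure_of ((topspace X - C) \<inter> V)"
    using V(1) by (auto simp: closure_of_subtopology)
  with P have "P \<inter> V \<noteq> {}"
    using openin_Int_closure_of_eq_empty[OF P(1), of "(topspace X - C) \<inter> V"] by blast
  then show thesis using that V(2) P(1) openin_subset by blast
qed

text \<open>A cofinal well-ordered subchain has the same union, so K4 computes the value as an
  infimum of numbers that are all at least \<open>c\<close>.\<close>

lemma quasi_kappa_metric_chain:
  assumes qk: "quasi_kappa_metric X \<rho>" and x: "x \<in> topspace X" and "L \<noteq> {}"
    and L: "\<And>S. S \<in> L \<Longrightarrow> regularly_closedin X S" "\<And>S. S \<in> L \<Longrightarrow> c \<le> \<rho> x S"
    and chain: "\<And>S T. S \<in> L \<Longrightarrow> T \<in> L \<Longrightarrow> S \<subseteq> T \<or> T \<subseteq> S"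
  shows "c \<le> \<rho> x (X closure_of (\<Union>L))"
proof -
  obtain W where W: "W \<subseteq> L" "well_order_on W {(S, T). S \<in> W \<and> T \<in> W \<and> S \<subseteq> T}"
    "\<And>S. S \<in> L \<Longrightarrow> \<exists>T\<in>W. S \<subseteq> T"
    using chain_cofinal_well_ordered[of L, OF chain] by blast
  have "W \<noteq> {}" using W(3) \<open>L \<noteq> {}\<close> by blast
  with W L(1) have "increasing_transfinite_family X W {(S, T). S \<in> W \<and> T \<in> W \<and> S \<subseteq> T} id"
    by (auto simp: increasing_transfinite_family_def)
  from quasi_kappa_metric_family[OF qk this x]
  have "\<rho> x (X closure_of (\<Union>W)) = (INF S\<in>W. \<rho> x S)" by simp
  moreover have "\<Union>L = \<Union>W" using W by blast
  moreover have "c \<le> (INF S\<in>W. \<rho> x S)"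
    using \<open>W \<noteq> {}\<close> W(1) L(2) by (intro cINF_greatest) auto
  ultimately show ?thesis by simp
qed

text \<open>
  K4 extends from chains to ideals: a maximal ideal on which \<open>\<rho> x\<close> stays above \<open>c\<close> is closed
  under suprema of chains, hence has a largest element.
\<close>

lemma quasi_kappa_metric_ideal:
  assumes qk: "quasi_kappa_metric X \<rho>" and x: "x \<in> topspace X" and "\<D> \<noteq> {}"
    and \<D>: "\<And>S. S \<in> \<D> \<Longrightarrow> regularly_closedin X S" "\<And>S. S \<in> \<D> \<Longrightarrow> c \<le> \<rho> x S"
    and Un: "\<And>S T. S \<in> \<D> \<Longrightarrow> T \<in> \<D> \<Longrightarrow> S \<union> T \<in> \<D>"
    and down: "\<And>S T. S \<in> \<D> \<Longrightarrow> regularly_closedin X T \<Longrightarrow> T \<subseteq> S \<Longrightarrow> T \<in> \<D>"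
  shows "c \<le> \<rho> x (X closure_of (\<Union>\<D>))"
proof -
  \<comment> \<open>The lower bound \<open>c\<close> is part of the notion, so that maximality is
    taken among ideals on which the value stays above \<open>c\<close>. All clauses survive unions
    of chains.\<close>
  define ideal where "ideal M \<longleftrightarrow>
      (\<forall>S\<in>M. regularly_closedin X S \<and> c \<le> \<rho> x S) \<and> (\<forall>S\<in>M. \<forall>T\<in>M. S \<union> T \<in> M) \<and>
      (\<forall>S\<in>M. \<forall>T. regularly_closedin X T \<and> T \<subseteq> S \<longrightarrow> T \<in> M)" for M
  define \<A> where "\<A> = {M. ideal M \<and> \<D> \<subseteq> M}"
  have "ideal \<D>" using \<D> Un down unfolding ideal_def by metis
  have "\<exists>M\<in>\<A>. \<forall>N\<in>\<A>. M \<subseteq> N \<longrightarrow> N = M"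
  proof (rule subset_Zorn_nonempty)
    show "\<A> \<noteq> {}" using \<open>ideal \<D>\<close> by (auto simp: \<A>_def)
    fix \<C> assume "\<C> \<noteq> {}" and \<C>: "subset.chain \<A> \<C>"
    then have chain: "\<And>M N. M \<in> \<C> \<Longrightarrow> N \<in> \<C> \<Longrightarrow> M \<subseteq> N \<or> N \<subseteq> M"
      and sub: "\<And>M. M \<in> \<C> \<Longrightarrow> ideal M \<and> \<D> \<subseteq> M"
      by (auto simp: subset_chain_def \<A>_def)
    have "S \<union> T \<in> \<Union>\<C>" if ST: "S \<in> \<Union>\<C>" "T \<in> \<Union>\<C>" for S T
    proof -
      obtain M N where "M \<in> \<C>" "S \<in> M" "N \<in> \<C>" "T \<in> N" using ST by blast
      then have "S \<in> M \<union> N" "T \<in> M \<union> N" "M \<union> N = M \<or> M \<union> N = N"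
        using chain[of M N] by auto
      then have "S \<union> T \<in> M \<union> N"
        using sub[of M] sub[of N] \<open>M \<in> \<C>\<close> \<open>N \<in> \<C>\<close> unfolding ideal_def by metis
      then show ?thesis using \<open>M \<in> \<C>\<close> \<open>N \<in> \<C>\<close> by blast
    qed
    moreover have "T \<in> \<Union>\<C>" if "S \<in> \<Union>\<C>" "regularly_closedin X T" "T \<subseteq> S" for S T
      using that sub unfolding ideal_def by (meson Union_iff)
    moreover have "regularly_closedin X S \<and> c \<le> \<rho> x S" if "S \<in> \<Union>\<C>" for S
      using that sub unfolding ideal_def by (meson Union_iff)
    ultimately have "ideal (\<Union>\<C>)" unfolding ideal_def by (intro conjI ballI allI impI) blast+
    moreover have "\<D> \<subseteq> \<Union>\<C>" using sub \<open>\<C> \<noteq> {}\<close> by blast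
    ultimately show "\<Union>\<C> \<in> \<A>" by (simp add: \<A>_def)
  qed
  then obtain M where "M \<in> \<A>" and M_max: "\<forall>N\<in>\<A>. M \<subseteq> N \<longrightarrow> N = M" by (rule bexE)
  then have M: "ideal M" "\<D> \<subseteq> M" by (auto simp: \<A>_def)
  have max: "N = M" if "ideal N" "M \<subseteq> N" for N
    using M_max M(2) that by (auto simp: \<A>_def)
  have M_Un: "S \<union> T \<in> M" if "S \<in> M" "T \<in> M" for S T
    using M(1) that unfolding ideal_def by blast
  have M_reg: "regularly_closedin X S" and M_ge: "c \<le> \<rho> x S" if "S \<in> M" for S
    using M(1) that unfolding ideal_def by blast+
  \<comment> \<open>A chain in \<open>M\<close> has its supremum in \<open>M\<close>, because
    adjoining that supremum gives an ideal with the same bound \<open>c\<close>.\<close>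
  have M_chain: "X closure_of (\<Union>L) \<in> M"
    if "L \<noteq> {}" "L \<subseteq> M" and chain: "\<And>S T. S \<in> L \<Longrightarrow> T \<in> L \<Longrightarrow> S \<subseteq> T \<or> T \<subseteq> S" for L
  proof -
    define l where "l = X closure_of (\<Union>L)"
    have l: "regularly_closedin X l"
      unfolding l_def using that M_reg by (intro regularly_closedin_closure_of_Union) auto
    \<comment> \<open>The sets \<open>a \<union> m\<close> with \<open>a\<close> in \<open>L\<close>
      form a chain in \<open>M\<close> with supremum \<open>l \<union> m\<close>, so K4 for chains
      applies.\<close>
    have l_Un: "c \<le> \<rho> x (l \<union> m)" if m: "m \<in> M" for m
    proof -
      have "X closure_of m = m"
        by (simp add: M_reg m closure_of_closedin regularly_closedin_closedin)
      moreover have "\<Union>((\<lambda>a. a \<union> m) ` L) = \<Union>L \<union> m" using \<open>L \<noteq> {}\<close> by auto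
      ultimately have eq: "X closure_of \<Union>((\<lambda>a. a \<union> m) ` L) = l \<union> m"
        by (simp add: l_def)
      have LM: "a \<union> m \<in> M" if "a \<in> L" for a using that \<open>L \<subseteq> M\<close> m M_Un by blast
      have "c \<le> \<rho> x (X closure_of \<Union>((\<lambda>a. a \<union> m) ` L))"
      proof (rule quasi_kappa_metric_chain[OF qk x])
        show "(\<lambda>a. a \<union> m) ` L \<noteq> {}" using \<open>L \<noteq> {}\<close> by simp
        show "\<And>S. S \<in> (\<lambda>a. a \<union> m) ` L \<Longrightarrow> regularly_closedin X S" using LM M_reg by blast
        show "\<And>S. S \<in> (\<lambda>a. a \<union> m) ` L \<Longrightarrow> c \<le> \<rho> x S" using LM M_ge by blast
        show "S \<subseteq> T \<or> T \<subseteq> S" if "S \<in> (\<lambda>a. a \<union> m) ` L" "T \<in> (\<lambda>a. a \<union> m) ` L" for S T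
          using that chain by blast
      qed
      then show ?thesis by (simp only: eq)
    qed
    \<comment> \<open>\<open>N\<close> is the ideal generated by \<open>M\<close> and
      \<open>l\<close>; maximality forces \<open>N = M\<close>.\<close>
    define N where "N = {b. regularly_closedin X b \<and> (\<exists>m\<in>M. b \<subseteq> l \<union> m)}"
    have "ideal N"
      unfolding ideal_def
    proof (intro conjI ballI allI impI)
      fix S assume "S \<in> N"
      then obtain m where m: "m \<in> M" "S \<subseteq> l \<union> m" and S: "regularly_closedin X S"
        by (auto simp: N_def)
      show "regularly_closedin X S" by (rule S)
      have "\<rho> x (l \<union> m) \<le> \<rho> x S"
        using m S l M_reg x by (intro quasi_kappa_metric_antimono[OF qk]) (auto intro: regularly_closedin_Un)
      then show "c \<le> \<rho> x S" using l_Un[OF m(1)] by simp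
      show "T \<in> N" if "regularly_closedin X T \<and> T \<subseteq> S" for T
        using that m by (auto simp: N_def)
      fix T assume "T \<in> N"
      then obtain k where k: "k \<in> M" "T \<subseteq> l \<union> k" and T: "regularly_closedin X T"
        by (auto simp: N_def)
      have "S \<union> T \<subseteq> l \<union> (m \<union> k)" using m k by auto
      then show "S \<union> T \<in> N" using S T m k M_Un regularly_closedin_Un unfolding N_def by blast
    qed
    moreover have "M \<subseteq> N" using M_reg by (auto simp: N_def)
    ultimately have "N = M" by (rule max)
    moreover have "l \<in> N" using l \<open>L \<noteq> {}\<close> \<open>L \<subseteq> M\<close> unfolding N_def by blast
    ultimately show ?thesis by (simp add: l_def)
  qed
  obtain S0 where S0: "S0 \<in> M" using \<open>\<D> \<noteq> {}\<close> M(2) by blast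
  \<comment> \<open>Zorn's lemma a second time, now inside \<open>M\<close>, with upper bounds from
    \<open>M_chain\<close>. Closure under unions turns the maximal member into a largest
    one.\<close>
  have "\<exists>m\<in>M. \<forall>S\<in>M. m \<subseteq> S \<longrightarrow> S = m"
  proof (rule subset_Zorn)
    fix \<C> assume \<C>: "subset.chain M \<C>"
    show "\<exists>U\<in>M. \<forall>S\<in>\<C>. S \<subseteq> U"
    proof (cases "\<C> = {}")
      case True
      then show ?thesis using S0 by blast
    next
      case False
      have "X closure_of (\<Union>\<C>) \<in> M"
        using \<C> False by (intro M_chain) (auto simp: subset_chain_def)
      moreover have "S \<subseteq> X closure_of (\<Union>\<C>)" if "S \<in> \<C>" for S
      proof -
        have "\<Union>\<C> \<subseteq> topspace X"
          using \<C> M_reg regularly_closedin_subset by (force simp: subset_chain_def)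
        then show ?thesis using closure_of_subset that by blast
      qed
      ultimately show ?thesis by blast
    qed
  qed
  then obtain m where m: "m \<in> M" and mmax: "\<And>S. S \<in> M \<Longrightarrow> m \<subseteq> S \<Longrightarrow> S = m" by blast
  have "S \<subseteq> m" if "S \<in> \<D>" for S
    using mmax[of "m \<union> S"] M_Un m M(2) that by blast
  then have "X closure_of (\<Union>\<D>) \<subseteq> m"
    using m M_reg by (intro closure_of_minimal) (auto simp: regularly_closedin_closedin)
  then have "\<rho> x m \<le> \<rho> x (X closure_of (\<Union>\<D>))"
    using m M_reg x \<D>(1)
    by (intro quasi_kappa_metric_antimono[OF qk] regularly_closedin_closure_of_Union) auto
  then show ?thesis using M_ge[OF m] by simp
qed

section \<open>Ultrafilters\<close>

text \<open>An ultrafilter is a minimal proper filter. Zorn's lemma applies downwards, since a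
  nonempty chain of proper filters is a filter base and its infimum stays proper.\<close>

lemma ultrafilter_exists:
  fixes F :: "'k filter"
  assumes "F \<noteq> bot"
  obtains G where "G \<le> F" "G \<noteq> bot"
    "\<And>P. eventually P G \<or> eventually (\<lambda>i. \<not> P i) G"
proof -
  define \<F> where "\<F> = {G. G \<noteq> bot \<and> G \<le> F}"
  have "\<exists>G\<in>\<F>. \<forall>H\<in>\<F>. H \<le> G \<longrightarrow> H = G"
  proof (rule predicate_Zorn[of \<F> "\<lambda>G H. H \<le> G"])
    show "partial_order_on \<F> (relation_of (\<lambda>G H. H \<le> G) \<F>)"
      by (rule partial_order_on_relation_ofI) auto
    fix \<C> assume \<C>: "\<C> \<in> Chains (relation_of (\<lambda>G H. H \<le> G) \<F>)"
    show "\<exists>H\<in>\<F>. \<forall>G\<in>\<C>. H \<le> G"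
    proof (cases "\<C> = {}")
      case True
      then show ?thesis using assms by (auto simp: \<F>_def)
    next
      case False
      have sub: "\<C> \<subseteq> \<F>" and chain: "\<And>G H. G \<in> \<C> \<Longrightarrow> H \<in> \<C> \<Longrightarrow> G \<le> H \<or> H \<le> G"
        using \<C> by (auto simp: Chains_def relation_of_def)
      have "\<exists>K\<in>\<C>. K \<le> inf G H" if "G \<in> \<C>" "H \<in> \<C>" for G H
        using chain[OF that] that by (metis inf_absorb1 inf_absorb2 order_refl)
      then have "eventually (\<lambda>_. False) (Inf \<C>) \<longleftrightarrow> (\<exists>G\<in>\<C>. eventually (\<lambda>_. False) G)"
        by (intro eventually_Inf_base False)
      then have "\<not> eventually (\<lambda>_. False) (Inf \<C>)"
        using sub by (auto simp: \<F>_def trivial_limit_def)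
      then have "Inf \<C> \<noteq> bot" by (simp add: trivial_limit_def)
      moreover have "Inf \<C> \<le> F"
        using False sub by (auto simp: \<F>_def intro: Inf_lower2)
      ultimately show ?thesis by (auto simp: \<F>_def Inf_lower intro!: bexI[of _ "Inf \<C>"])
    qed
  qed
  then obtain G where G: "G \<noteq> bot" "G \<le> F"
    and min: "\<And>H. H \<noteq> bot \<Longrightarrow> H \<le> G \<Longrightarrow> H = G"
    unfolding \<F>_def by (metis (mono_tags, lifting) mem_Collect_eq order_trans)
  have "eventually P G \<or> eventually (\<lambda>i. \<not> P i) G" for P
  \<comment> \<open>The restriction of \<open>G\<close> to the set where \<open>P\<close> holds is
    either improper, and \<open>P\<close> eventually fails, or equal to \<open>G\<close> by
    minimality, and \<open>P\<close> eventually holds.\<close>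
  proof (cases "inf G (principal {i. P i}) = bot")
    case True
    then show ?thesis
      by (auto simp: trivial_limit_def eventually_inf_principal)
  next
    case False
    then have "inf G (principal {i. P i}) = G" by (rule min) simp
    then have "G \<le> principal {i. P i}" by (metis inf.cobounded2)
    then show ?thesis by (simp add: le_principal)
  qed
  then show thesis using that G by blast
qed

text \<open>Turns a choice from a finite set that may vary with the index into a constant one: if
  each \<open>P a\<close> eventually failed, all would fail together by finiteness.\<close>

lemma ultrafilter_bex_finite:
  assumes "\<And>P. eventually P G \<or> eventually (\<lambda>i. \<not> P i) G" "G \<noteq> bot"
    and "finite F" "eventually (\<lambda>i. \<exists>a\<in>F. P a i) G"
  shows "\<exists>a\<in>F. eventually (P a) G"
proof (rule ccontr)
  assume "\<not> ?thesis"
  then have "\<forall>a\<in>F. eventually (\<lambda>i. \<not> P a i) G" using assms(1) by blast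
  then have "eventually (\<lambda>i. \<forall>a\<in>F. \<not> P a i) G"
    using \<open>finite F\<close> by (simp add: eventually_ball_finite)
  then have "eventually (\<lambda>_. False) G" using assms(4) by eventually_elim blast
  then show False using \<open>G \<noteq> bot\<close> by (simp add: trivial_limit_def)
qed

section \<open>Boxes and cylinders in products\<close>

text \<open>Otherwise each \<open>Q a\<close> with \<open>a\<close> in \<open>B\<close> has a point
  outside \<open>D a\<close>. Overwriting the coordinates in \<open>B\<close> of a point of the box
  by these gives a point of the box in no cylinder.\<close>

lemma box_subset_cylinder:
  assumes "PiE A Q \<noteq> {}" "B \<subseteq> A" and sub: "PiE A Q \<subseteq> {y. \<exists>a\<in>B. y a \<in> D a}"
  shows "\<exists>a\<in>B. Q a \<subseteq> D a"
proof (rule ccontr)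
  assume "\<not> ?thesis"
  then have "\<forall>a\<in>B. \<exists>z. z \<in> Q a \<and> z \<notin> D a" by blast
  then obtain z where z: "\<And>a. a \<in> B \<Longrightarrow> z a \<in> Q a \<and> z a \<notin> D a" by metis
  obtain y where y: "y \<in> PiE A Q" using assms(1) by blast
  define w where "w a = (if a \<in> B then z a else y a)" for a
  have "w \<in> PiE A Q"
    using y z \<open>B \<subseteq> A\<close> by (auto simp: w_def PiE_iff extensional_def)
  then obtain a where "a \<in> B" "w a \<in> D a" using sub by blast
  then show False using z by (simp add: w_def)
qed

lemma openin_product_topology_boxE:
  assumes "openin (product_topology X A) U" "y \<in> U"
  obtains Q where "finite {a \<in> A. Q a \<noteq> topspace (X a)}" "\<And>a. a \<in> A \<Longrightarrow> openin (X a) (Q a)"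
    "y \<in> PiE A Q" "PiE A Q \<subseteq> U"
proof -
  have "\<exists>Q. finite {a \<in> A. Q a \<noteq> topspace (X a)} \<and> (\<forall>a\<in>A. openin (X a) (Q a)) \<and>
      y \<in> PiE A Q \<and> PiE A Q \<subseteq> U"
    using assms by (simp add: openin_product_topology_alt)
  then show thesis using that by auto
qed

text \<open>A finite union of closed cylinders is closed. Hence covering by cylinders needs to be
  verified only on an open set generating a regularly closed one.\<close>

lemma closure_of_subset_cylinder:
  assumes "finite B" "B \<subseteq> A" and D: "\<And>a. a \<in> B \<Longrightarrow> closedin (X a) (D a)"
    and U: "openin (product_topology X A) U" "U \<subseteq> {y. \<exists>a\<in>B. y a \<in> D a}"
  shows "product_topology X A closure_of U \<subseteq> {y. \<exists>a\<in>B. y a \<in> D a}"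
proof -
  let ?P = "product_topology X A"
  let ?K = "\<Union>a\<in>B. {y \<in> topspace ?P. y a \<in> D a}"
  have "closedin ?P {y \<in> topspace ?P. y a \<in> D a}" if "a \<in> B" for a
    using that assms(2) D
    by (intro closedin_continuous_map_preimage[OF continuous_map_product_projection]) auto
  then have "closedin ?P ?K"
    using assms(1) by (intro closedin_Union) auto
  moreover have "U \<subseteq> ?K" using openin_subset[OF U(1)] U(2) by blast
  ultimately have "?P closure_of U \<subseteq> ?K" by (simp add: closure_of_minimal)
  then show ?thesis by blast
qed

section \<open>Witnesses and the function on the product\<close>

locale quasi_kappa_product =
  fixes X :: "'i \<Rightarrow> 'a topology" and A :: "'i set" and \<rho> :: "'i \<Rightarrow> 'a \<Rightarrow> 'a set \<Rightarrow> real"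
  assumes qk: "\<And>a. a \<in> A \<Longrightarrow> quasi_kappa_metric (X a) (\<rho> a)"
begin

abbreviation P :: "('i \<Rightarrow> 'a) topology" where
  "P \<equiv> product_topology X A"

text \<open>The \<open>+ 1\<close> accommodates empty \<open>B\<close>, which can occur only for
  empty \<open>C\<close>, and bounds positive levels by 1, so that their supremum is finite. For
  fixed positive \<open>c\<close> the product inequality is a bound on
  \<open>card B\<close>.\<close>

definition level :: "('i \<Rightarrow> 'a) \<Rightarrow> ('i \<Rightarrow> 'a) set \<Rightarrow> real \<Rightarrow> bool" where
  "level x C c \<longleftrightarrow> (\<exists>B D. finite B \<and> B \<subseteq> A \<and> c * (real (card B) + 1) \<le> 1 \<and>
     (\<forall>a\<in>B. regularly_closedin (X a) (D a) \<and> c \<le> \<rho> a (x a) (D a)) \<and>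
     C \<subseteq> {y. \<exists>a\<in>B. y a \<in> D a})"

definition prod_kappa :: "('i \<Rightarrow> 'a) \<Rightarrow> ('i \<Rightarrow> 'a) set \<Rightarrow> real" where
  "prod_kappa x C = Sup (insert 0 {c. 0 < c \<and> level x C c})"

lemma levelI:
  assumes "finite B" "B \<subseteq> A" "c * (real (card B) + 1) \<le> 1"
    "\<And>a. a \<in> B \<Longrightarrow> regularly_closedin (X a) (D a)" "\<And>a. a \<in> B \<Longrightarrow> c \<le> \<rho> a (x a) (D a)"
    "C \<subseteq> {y. \<exists>a\<in>B. y a \<in> D a}"
  shows "level x C c"
  using assms unfolding level_def by blast

lemma levelE:
  assumes "level x C c"
  obtains B D where "finite B" "B \<subseteq> A" "c * (real (card B) + 1) \<le> 1"
    "\<And>a. a \<in> B \<Longrightarrow> regularly_closedin (X a) (D a)" "\<And>a. a \<in> B \<Longrightarrow> c \<le> \<rho> a (x a) (D a)"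
    "C \<subseteq> {y. \<exists>a\<in>B. y a \<in> D a}"
  using assms unfolding level_def by blast

lemma topspace_component: "x \<in> topspace P \<Longrightarrow> a \<in> A \<Longrightarrow> x a \<in> topspace (X a)"
  by (auto simp: PiE_iff)

lemma level_mono:
  assumes "level x C c" "C' \<subseteq> C" "c' \<le> c"
  shows "level x C' c'"
  using assms(1)
proof (rule levelE)
  fix B D
  assume B: "finite B" "B \<subseteq> A" "c * (real (card B) + 1) \<le> 1"
    "\<And>a. a \<in> B \<Longrightarrow> regularly_closedin (X a) (D a)" "\<And>a. a \<in> B \<Longrightarrow> c \<le> \<rho> a (x a) (D a)"
    "C \<subseteq> {y. \<exists>a\<in>B. y a \<in> D a}"
  have "c' * (real (card B) + 1) \<le> c * (real (card B) + 1)"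
    using assms(3) by (intro mult_right_mono) auto
  then have "c' * (real (card B) + 1) \<le> 1" using B(3) by linarith
  moreover have "c' \<le> \<rho> a (x a) (D a)" if "a \<in> B" for a
    using B(5)[OF that] assms(3) by linarith
  ultimately show ?thesis
    using B assms(2) by (intro levelI[of B c' D]) auto
qed

lemma level_le_1:
  assumes "level x C c" "0 < c" shows "c \<le> 1"
proof -
  obtain B :: "'i set" where "c * (real (card B) + 1) \<le> 1" using assms(1) unfolding level_def by auto
  moreover have "0 \<le> c * real (card B)" using assms(2) by simp
  ultimately show ?thesis by (simp add: distrib_left)
qed

lemma bdd_above_levels: "bdd_above (insert 0 {c. 0 < c \<and> level x C c})"
  by (rule bdd_aboveI[of _ 1]) (auto dest: level_le_1)

lemma prod_kappa_nonneg: "0 \<le> prod_kappa x C"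
  unfolding prod_kappa_def by (rule cSup_upper[OF _ bdd_above_levels]) simp

lemma level_le_prod_kappa: "level x C c \<Longrightarrow> 0 < c \<Longrightarrow> c \<le> prod_kappa x C"
  unfolding prod_kappa_def by (rule cSup_upper[OF _ bdd_above_levels]) simp

lemma less_prod_kappaE:
  assumes "c < prod_kappa x C" "0 \<le> c"
  obtains c' where "c < c'" "level x C c'"
  using assms less_cSup_iff[OF _ bdd_above_levels, of x C c] by (auto simp: prod_kappa_def)

lemma level_if_less_prod_kappa: "c < prod_kappa x C \<Longrightarrow> 0 \<le> c \<Longrightarrow> level x C c"
  by (meson less_prod_kappaE level_mono order_refl less_imp_le)

text \<open>Only levels strictly below \<open>c\<close> have to be exhibited, so it does not matter
  whether the supremum is attained.\<close>

lemma le_prod_kappaI: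
  assumes "\<And>c'. 0 < c' \<Longrightarrow> c' < c \<Longrightarrow> level x C c'"
  shows "c \<le> prod_kappa x C"
proof (rule ccontr)
  assume "\<not> ?thesis"
  then have "prod_kappa x C < c" by simp
  then obtain c' where "prod_kappa x C < c'" "c' < c" using dense by blast
  moreover have "0 < c'" using calculation prod_kappa_nonneg[of x C] by linarith
  ultimately show False using level_le_prod_kappa[OF assms, of c'] by simp
qed

section \<open>Limits of witnesses and axiom K3\<close>

lemma openin_less:
  assumes "a \<in> A" "regularly_closedin (X a) D"
  shows "openin P {y \<in> topspace P. \<rho> a (y a) D < c}" "openin P {y \<in> topspace P. c < \<rho> a (y a) D}"
proof -
  have "continuous_map P euclideanreal ((\<lambda>z. \<rho> a z D) \<circ> (\<lambda>y. y a))"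
    using assms by (intro continuous_map_compose[OF continuous_map_product_projection]
        quasi_kappa_metric_continuous qk)
  then have "continuous_map P euclideanreal (\<lambda>y. \<rho> a (y a) D)" by (simp add: o_def)
  then show "openin P {y \<in> topspace P. \<rho> a (y a) D < c}" "openin P {y \<in> topspace P. c < \<rho> a (y a) D}"
    unfolding continuous_map_upper_lower_semicontinuous_lt by blast+
qed

text \<open>
  The limit of the \<open>D i a\<close> along \<open>G\<close> is the closure of the union of all regularly closed sets that
  are eventually contained in \<open>D i a\<close>; these sets form an ideal.
\<close>

lemma level_limit:
  fixes G :: "'k filter"
  assumes ultra: "\<And>R. eventually R G \<or> eventually (\<lambda>i. \<not> R i) G" and G: "G \<noteq> bot"
    and c: "0 < c" and x: "x \<in> topspace P"
    and xs: "\<And>W. openin P W \<Longrightarrow> x \<in> W \<Longrightarrow> eventually (\<lambda>i. xs i \<in> W) G"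
    and lev: "eventually (\<lambda>i. level (xs i) (Cs i) c) G"
    and U: "openin P U"
    and loc: "\<And>p. p \<in> U \<Longrightarrow> \<exists>W. openin P W \<and> p \<in> W \<and> eventually (\<lambda>i. W \<subseteq> Cs i) G"
  shows "level x (P closure_of U) c"
proof -
  define good where "good i B D \<longleftrightarrow> finite B \<and> B \<subseteq> A \<and> c * (real (card B) + 1) \<le> 1 \<and>
      (\<forall>a\<in>B. regularly_closedin (X a) (D a) \<and> c \<le> \<rho> a (xs i a) (D a)) \<and>
      Cs i \<subseteq> {y. \<exists>a\<in>B. y a \<in> D a}" for i B D
  have "\<forall>i. \<exists>BD. level (xs i) (Cs i) c \<longrightarrow> good i (fst BD) (snd BD)"
    by (auto simp: level_def good_def)
  then obtain BD where "\<forall>i. level (xs i) (Cs i) c \<longrightarrow> good i (fst (BD i)) (snd (BD i))"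
    by (rule choice[THEN exE])
  moreover define B D where "B i = fst (BD i)" and "D i = snd (BD i)" for i
  ultimately have BD0: "good i (B i) (D i)" if "level (xs i) (Cs i) c" for i
    using that by simp
  note BD = BD0[unfolded good_def]
  have top: "eventually (\<lambda>i. xs i \<in> topspace P) G"
    using xs[of "topspace P"] x openin_topspace by blast
  define BL where "BL = {a \<in> A. eventually (\<lambda>i. a \<in> B i) G}"
  define fam where "fam a = {E. regularly_closedin (X a) E \<and> eventually (\<lambda>i. a \<in> B i \<and> E \<subseteq> D i a) G}" for a
  define DL where "DL a = X a closure_of \<Union>(fam a)" for a
  \<comment> \<open>A finite part of \<open>BL\<close> lies in a single \<open>B i\<close> and
    inherits its cardinality bound. The bound is uniform, so \<open>BL\<close> itself is
    finite.\<close>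
  have card: "c * (real (card K) + 1) \<le> 1" if K: "K \<subseteq> BL" "finite K" for K
  proof -
    have "\<forall>a\<in>K. eventually (\<lambda>i. a \<in> B i) G" using K by (auto simp: BL_def)
    then have "eventually (\<lambda>i. \<forall>a\<in>K. a \<in> B i) G" using K by (simp add: eventually_ball_finite)
    with lev have "eventually (\<lambda>i. level (xs i) (Cs i) c \<and> K \<subseteq> B i) G"
      by eventually_elim auto
    then obtain i where i: "level (xs i) (Cs i) c" "K \<subseteq> B i"
      using eventually_happens'[OF G] by blast
    have "card K \<le> card (B i)" using BD[OF i(1)] i(2) by (simp add: card_mono)
    then have "c * (real (card K) + 1) \<le> c * (real (card (B i)) + 1)" using c by simp
    then show ?thesis using BD[OF i(1)] by linarith
  qed
  have "card K \<le> nat \<lfloor>1 / c\<rfloor>" if "K \<subseteq> BL" "finite K" for K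
  proof -
    have "real (card K) * c \<le> 1" using card[OF that] c by (simp add: algebra_simps)
    then have "real (card K) \<le> 1 / c" using c by (simp add: field_simps)
    then show ?thesis by (simp add: le_nat_floor)
  qed
  then have fin: "finite BL" using finite_if_finite_subsets_card_bdd by blast
  have DL_reg: "regularly_closedin (X a) (DL a)" for a
    unfolding DL_def by (rule regularly_closedin_closure_of_Union) (simp add: fam_def)
  \<comment> \<open>If the value at \<open>x a\<close> were below \<open>c\<close>, continuity would
    eventually keep \<open>\<rho> a (xs i a) E\<close> below \<open>c\<close>, whereas
    \<open>E \<subseteq> D i a\<close> and K2 keep it at least \<open>c\<close>.\<close>
  have fam_le: "c \<le> \<rho> a (x a) E" if a: "a \<in> BL" and E: "E \<in> fam a" for a E
  proof (rule ccontr)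
    assume n: "\<not> ?thesis"
    have aA: "a \<in> A" and Ereg: "regularly_closedin (X a) E"
      and Eev: "eventually (\<lambda>i. a \<in> B i \<and> E \<subseteq> D i a) G"
      using a E by (auto simp: BL_def fam_def)
    have "eventually (\<lambda>i. xs i \<in> {y \<in> topspace P. \<rho> a (y a) E < c}) G"
      using n x by (intro xs openin_less(1) aA Ereg) auto
    with lev Eev have "eventually (\<lambda>_. False) G"
    proof eventually_elim
      case (elim i)
      have "regularly_closedin (X a) (D i a)" "c \<le> \<rho> a (xs i a) (D i a)"
        using BD[OF elim(1)] elim(2) by auto
      moreover have "\<rho> a (xs i a) (D i a) \<le> \<rho> a (xs i a) E"
        using elim calculation Ereg aA topspace_component[of "xs i" a]
        by (intro quasi_kappa_metric_antimono[OF qk]) auto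
      ultimately show False using elim by auto
    qed
    then show False using G by (simp add: trivial_limit_def)
  qed
  show ?thesis
  proof (rule levelI[of BL c DL])
    show "finite BL" "BL \<subseteq> A" using fin by (auto simp: BL_def)
    show "c * (real (card BL) + 1) \<le> 1" using card fin by blast
    fix a assume a: "a \<in> BL"
    then have aA: "a \<in> A" by (simp add: BL_def)
    show "regularly_closedin (X a) (DL a)" by (rule DL_reg)
    show "c \<le> \<rho> a (x a) (DL a)"
      unfolding DL_def
    proof (rule quasi_kappa_metric_ideal[OF qk[OF aA] topspace_component[OF x aA]])
      have "{} \<in> fam a" using a by (simp add: fam_def BL_def regularly_closedin_empty)
      then show "fam a \<noteq> {}" by blast
      show "regularly_closedin (X a) S" if "S \<in> fam a" for S using that by (simp add: fam_def)
      show "c \<le> \<rho> a (x a) S" if "S \<in> fam a" for S using fam_le a that by blast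
      show "S \<union> T \<in> fam a" if "S \<in> fam a" "T \<in> fam a" for S T
      proof -
        have "eventually (\<lambda>i. a \<in> B i \<and> S \<subseteq> D i a) G" "eventually (\<lambda>i. a \<in> B i \<and> T \<subseteq> D i a) G"
          using that by (auto simp: fam_def)
        then have "eventually (\<lambda>i. a \<in> B i \<and> S \<union> T \<subseteq> D i a) G" by eventually_elim auto
        then show ?thesis using that regularly_closedin_Un by (auto simp: fam_def)
      qed
      show "T \<in> fam a" if S: "S \<in> fam a" and T: "regularly_closedin (X a) T" "T \<subseteq> S" for S T
      proof -
        have "eventually (\<lambda>i. a \<in> B i \<and> S \<subseteq> D i a) G" using S by (simp add: fam_def)
        then have "eventually (\<lambda>i. a \<in> B i \<and> T \<subseteq> D i a) G" by eventually_elim (use T in auto)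
        then show ?thesis using T by (simp add: fam_def)
      qed
    qed
  next
    show "P closure_of U \<subseteq> {y. \<exists>a\<in>BL. y a \<in> DL a}"
    proof (rule closure_of_subset_cylinder[OF fin _ _ U])
      show "BL \<subseteq> A" by (auto simp: BL_def)
      show "closedin (X a) (DL a)" for a using DL_reg regularly_closedin_closedin by blast
      show "U \<subseteq> {y. \<exists>a\<in>BL. y a \<in> DL a}"
      proof (intro subsetI CollectI)
        fix y assume "y \<in> U"
        then obtain W where W: "openin P W" "y \<in> W" "eventually (\<lambda>i. W \<subseteq> Cs i) G" using loc by blast
        obtain R where R: "finite {a \<in> A. R a \<noteq> topspace (X a)}"
          "\<And>a. a \<in> A \<Longrightarrow> openin (X a) (R a)" "y \<in> PiE A R" "PiE A R \<subseteq> W"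
          using W(1,2) by (rule openin_product_topology_boxE) blast
        \<comment> \<open>Only the finitely many coordinates restricted by the box can occur: the
          value at \<open>xs i a\<close> is positive, so \<open>D i a\<close> misses this point, and
          \<open>R a \<subseteq> D i a\<close> cannot be the whole factor.\<close>
        let ?F = "{a \<in> A. R a \<noteq> topspace (X a)}"
        from lev W(3) top have "eventually (\<lambda>i. \<exists>a\<in>?F. a \<in> B i \<and> R a \<subseteq> D i a) G"
        proof eventually_elim
          case (elim i)
          note BDi = BD[OF elim(1)]
          have "PiE A R \<subseteq> {y. \<exists>a\<in>B i. y a \<in> D i a}"
            using R(4) elim(2) BDi by (meson order_trans)
          then have "\<exists>a\<in>B i. R a \<subseteq> D i a"
            using BDi R(3) by (intro box_subset_cylinder[of A]) auto
          then obtain a where a: "a \<in> B i" "R a \<subseteq> D i a" by blast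
          have aA: "a \<in> A" using a BDi by auto
          have xa: "xs i a \<in> topspace (X a)" using elim(3) aA by (rule topspace_component)
          have "regularly_closedin (X a) (D i a)" "c \<le> \<rho> a (xs i a) (D i a)" using BDi a(1) by auto
          then have "xs i a \<notin> D i a"
            using c xa by (intro quasi_kappa_metric_notin[OF qk[OF aA]]) auto
          then have "R a \<noteq> topspace (X a)" using a(2) xa by blast
          then show ?case using a aA by blast
        qed
        \<comment> \<open>The ultrafilter makes the coordinate \<open>a\<close> independent of
          \<open>i\<close>. As \<open>D i a\<close> is closed, it also contains the closure of
          \<open>R a\<close>, a regularly closed set that thus belongs to
          \<open>fam a\<close>.\<close>
        from ultrafilter_bex_finite[OF ultra G R(1) this]
        obtain a where a: "a \<in> A" "eventually (\<lambda>i. a \<in> B i \<and> R a \<subseteq> D i a) G" by blast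
        have aBL: "a \<in> BL"
          using a by (auto simp: BL_def elim: eventually_mono)
        have "eventually (\<lambda>i. a \<in> B i \<and> X a closure_of R a \<subseteq> D i a) G"
          using a(2) lev
        proof eventually_elim
          case (elim i)
          then have "closedin (X a) (D i a)"
            using BD[of i] regularly_closedin_closedin by blast
          then show ?case using elim by (simp add: closure_of_minimal)
        qed
        then have "X a closure_of R a \<in> fam a"
          using regularly_closedin_closure_of[OF R(2)[OF a(1)]] by (simp add: fam_def)
        moreover have "\<Union>(fam a) \<subseteq> DL a"
          unfolding DL_def by (intro closure_of_subset) (auto simp: fam_def dest: regularly_closedin_subset)
        moreover have "R a \<subseteq> X a closure_of R a"
          using R(2)[OF a(1)] by (intro closure_of_subset openin_subset)
        moreover have "y a \<in> R a" using R(3) a(1) by auto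
        ultimately show "\<exists>a\<in>BL. y a \<in> DL a" using aBL by blast
      qed
    qed
  qed
qed

text \<open>A point of the closure is the limit of an ultrafilter living on the level set, and
  witnesses pass to the limit. Here the set is constant and only the point varies.\<close>

lemma closedin_level:
  assumes "regularly_closedin P C" "0 < c"
  shows "closedin P {x \<in> topspace P. level x C c}"
proof -
  obtain U where U: "openin P U" "C = P closure_of U"
    using assms(1) by (auto simp: regularly_closedin_def)
  let ?S = "{x \<in> topspace P. level x C c}"
  have "P closure_of ?S \<subseteq> ?S"
  proof
    fix x assume x: "x \<in> P closure_of ?S"
    then have xt: "x \<in> topspace P" by (simp add: in_closure_of)
    \<comment> \<open>The trace of the neighbourhood filter of \<open>x\<close> on the level set,
      proper because \<open>x\<close> is in the closure. The points themselves serve as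
      indices.\<close>
    define F where "F = inf (nhdsin P x) (principal ?S)"
    have F: "eventually R F \<longleftrightarrow> (\<exists>W. openin P W \<and> x \<in> W \<and> (\<forall>y\<in>W. y \<in> ?S \<longrightarrow> R y))" for R
      using xt unfolding F_def eventually_inf_principal eventually_nhdsin by simp
    have "F \<noteq> bot"
    proof
      assume "F = bot"
      then have "eventually (\<lambda>_. False) F" by simp
      then obtain W where "openin P W" "x \<in> W" "\<forall>y\<in>W. y \<notin> ?S" unfolding F by blast
      then show False using x unfolding in_closure_of by blast
    qed
    then obtain G where G: "G \<le> F" "G \<noteq> bot"
      "\<And>R. eventually R G \<or> eventually (\<lambda>i. \<not> R i) G"
      using ultrafilter_exists by blast
    have "level x (P closure_of U) c"
    proof (rule level_limit[OF G(3,2) assms(2) xt])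
      show "eventually (\<lambda>i. i \<in> W) G" if "openin P W" "x \<in> W" for W
        using that by (intro filter_leD[OF G(1)]) (auto simp: F)
      have "eventually (\<lambda>i. level i C c) F" using xt openin_topspace[of P] by (auto simp: F)
      then show "eventually (\<lambda>i. level i C c) G" by (rule filter_leD[OF G(1)])
      show "openin P U" by (rule U(1))
      show "\<exists>W. openin P W \<and> p \<in> W \<and> eventually (\<lambda>i. W \<subseteq> C) G" if "p \<in> U" for p
        using that U closure_of_subset[OF openin_subset[OF U(1)]] by auto
    qed
    then show "x \<in> ?S" using xt U(2) by simp
  qed
  then show ?thesis by (subst closure_of_subset_eq[symmetric]) auto
qed

lemma prod_kappa_continuous:
  assumes C: "regularly_closedin P C"
  shows "continuous_map P euclideanreal (\<lambda>x. prod_kappa x C)"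
  unfolding continuous_map_upper_lower_semicontinuous_lt
proof (intro conjI allI)
  fix c
  show "openin P {x \<in> topspace P. c < prod_kappa x C}"
  proof (cases "c < 0")
    case True
    then have "{x \<in> topspace P. c < prod_kappa x C} = topspace P"
      using prod_kappa_nonneg by (auto intro: less_le_trans)
    then show ?thesis by (simp only: openin_topspace)
  next
    case False
    show ?thesis
    proof (subst openin_subopen, intro ballI)
      fix x assume "x \<in> {x \<in> topspace P. c < prod_kappa x C}"
      then have x: "x \<in> topspace P" "c < prod_kappa x C" by auto
      obtain e where e: "c < e" "level x C e" using x(2) False less_prod_kappaE[of c x C] by auto
      \<comment> \<open>A level strictly between leaves room: the witness for \<open>x\<close> at
        level \<open>e\<close> serves at level \<open>d\<close> for all points near
        \<open>x\<close>.\<close>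
      obtain d where d: "c < d" "d < e" using dense[OF e(1)] by blast
      obtain B D where B: "finite B" "B \<subseteq> A" "e * (real (card B) + 1) \<le> 1"
        "\<And>a. a \<in> B \<Longrightarrow> regularly_closedin (X a) (D a)" "\<And>a. a \<in> B \<Longrightarrow> e \<le> \<rho> a (x a) (D a)"
        "C \<subseteq> {y. \<exists>a\<in>B. y a \<in> D a}"
        using e(2) by (rule levelE) blast
      \<comment> \<open>Intersecting with \<open>topspace P\<close> gives the right neighbourhood
        also for empty \<open>B\<close>.\<close>
      let ?W = "topspace P \<inter> (\<Inter>a\<in>B. {y \<in> topspace P. d < \<rho> a (y a) (D a)})"
      have Weq: "?W = \<Inter>(insert (topspace P) ((\<lambda>a. {y \<in> topspace P. d < \<rho> a (y a) (D a)}) ` B))"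
        by simp
      have "openin P ?W"
        unfolding Weq
      proof (rule openin_Inter)
        show "openin P Z" if Z: "Z \<in> insert (topspace P) ((\<lambda>a. {y \<in> topspace P. d < \<rho> a (y a) (D a)}) ` B)" for Z
        proof -
          consider "Z = topspace P" | a where "a \<in> B" "Z = {y \<in> topspace P. d < \<rho> a (y a) (D a)}"
            using Z by blast
          then show ?thesis
          proof cases
            case 1
            then show ?thesis by (simp only: openin_topspace)
          next
            case 2
            then have "a \<in> A" using B(2) by blast
            then show ?thesis unfolding 2(2) by (rule openin_less(2)) (rule B(4)[OF 2(1)])
          qed
        qed
      qed (use B(1) in auto)
      moreover have "x \<in> ?W"
        using x(1) B(5) d(2) by (auto intro: less_le_trans simp del: topspace_product_topology)
      moreover have "?W \<subseteq> {x \<in> topspace P. c < prod_kappa x C}"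
      proof (intro subsetI CollectI conjI)
        fix y assume y: "y \<in> ?W"
        then show "y \<in> topspace P" by (rule IntD1)
        have "d * (real (card B) + 1) \<le> e * (real (card B) + 1)"
          using d(2) by (intro mult_right_mono) auto
        then have "d * (real (card B) + 1) \<le> 1" using B(3) by linarith
        then have "level y C d"
          using B y by (intro levelI[of B d D]) (auto simp: less_imp_le)
        then show "c < prod_kappa y C"
          using level_le_prod_kappa[of y C d] d False by simp
      qed
      ultimately show "\<exists>T. openin P T \<and> x \<in> T \<and> T \<subseteq> {x \<in> topspace P. c < prod_kappa x C}"
        by blast
    qed
  qed
  have "closedin P {x \<in> topspace P. c \<le> prod_kappa x C}"
  proof (cases "c \<le> 0")
    case True
    then have "{x \<in> topspace P. c \<le> prod_kappa x C} = topspace P"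
      using prod_kappa_nonneg by (auto intro: order_trans)
    then show ?thesis by (simp only: closedin_topspace)
  next
    case False
    \<comment> \<open>The superlevel set at \<open>c\<close> is the intersection of the closed level
      sets for all smaller positive \<open>d\<close>.\<close>
    have "c \<le> prod_kappa x C \<longleftrightarrow> (\<forall>d\<in>{0<..<c}. level x C d)" for x
      using le_prod_kappaI[of c x C] level_if_less_prod_kappa[of _ x C] by auto
    then have eq: "{x \<in> topspace P. c \<le> prod_kappa x C} =
        \<Inter>((\<lambda>d. {x \<in> topspace P. level x C d}) ` {0<..<c})"
      using False dense[of 0 c] by auto
    show ?thesis
      unfolding eq using False dense[of 0 c] closedin_level[OF C] by (intro closedin_Inter) auto
  qed
  then have "openin P (topspace P - {x \<in> topspace P. c \<le> prod_kappa x C})"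
    by (rule openin_diff[OF openin_topspace])
  moreover have "topspace P - {x \<in> topspace P. c \<le> prod_kappa x C} = {x \<in> topspace P. prod_kappa x C < c}"
    by auto
  ultimately show "openin P {x \<in> topspace P. prod_kappa x C < c}"
    by (simp only:)
qed

section \<open>Axioms K2 and K1*\<close>

lemma prod_kappa_antimono:
  assumes "C \<subseteq> C'"
  shows "prod_kappa x C' \<le> prod_kappa x C"
proof (rule le_prod_kappaI)
  fix c assume "0 < c" "c < prod_kappa x C'"
  then have "level x C' c" by (intro level_if_less_prod_kappa) auto
  then show "level x C c" using assms by (rule level_mono) simp
qed

lemma prod_kappa_notin:
  assumes x: "x \<in> topspace P" and "0 < prod_kappa x C"
  shows "x \<notin> C"
proof
  assume "x \<in> C"
  obtain c where c: "0 < c" "level x C c" using less_prod_kappaE[OF assms(2)] by auto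
  obtain B D where B: "B \<subseteq> A"
      "\<And>a. a \<in> B \<Longrightarrow> regularly_closedin (X a) (D a)" "\<And>a. a \<in> B \<Longrightarrow> c \<le> \<rho> a (x a) (D a)"
      "C \<subseteq> {y. \<exists>a\<in>B. y a \<in> D a}"
    using c(2) by (rule levelE) blast
  then obtain a where a: "a \<in> B" "x a \<in> D a" using \<open>x \<in> C\<close> by blast
  then have "x a \<notin> D a"
    using B c x topspace_component[of x a]
    by (intro quasi_kappa_metric_notin[OF qk]) (auto simp del: topspace_product_topology intro: less_le_trans)
  then show False using a by simp
qed

text \<open>This yields the density in K1*. For a box in \<open>W\<close> with sides
  \<open>Q a\<close>, let \<open>D a\<close> be generated by the exterior of \<open>Q a\<close>; K1*
  in the factors supplies a point of the box with positive values. The cylinders over the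
  \<open>D a\<close> cover \<open>C\<close>, since boxes inside its generating open set miss the box
  in \<open>W\<close>.\<close>

lemma prod_kappa_meets:
  assumes C: "regularly_closedin P C" and W: "openin P W" "W \<noteq> {}" "W \<inter> C = {}"
  shows "\<exists>x\<in>W. 0 < prod_kappa x C"
proof -
  obtain U where U: "openin P U" "C = P closure_of U"
    using C by (auto simp: regularly_closedin_def)
  have "U \<subseteq> C" using U closure_of_subset openin_subset by metis
  obtain p where p: "p \<in> W" using W(2) by blast
  obtain Q where Q: "finite {a \<in> A. Q a \<noteq> topspace (X a)}" "\<And>a. a \<in> A \<Longrightarrow> openin (X a) (Q a)"
    "p \<in> PiE A Q" "PiE A Q \<subseteq> W"
    using W(1) p by (rule openin_product_topology_boxE) blast
  define B where "B = {a \<in> A. Q a \<noteq> topspace (X a)}"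
  define D where "D a = X a closure_of (topspace (X a) - X a closure_of Q a)" for a
  have B: "finite B" "B \<subseteq> A" using Q(1) by (auto simp: B_def)
  have D_reg: "regularly_closedin (X a) (D a)" for a
    unfolding D_def by (rule regularly_closedin_closure_of) (simp add: openin_diff)
  have Q_D: "Q a \<inter> D a = {}" if "a \<in> A" for a
  proof -
    have "Q a \<inter> (topspace (X a) - X a closure_of Q a) = {}"
      using closure_of_subset[OF openin_subset[OF Q(2)[OF that]]] by auto
    then show ?thesis unfolding D_def by (simp add: openin_Int_closure_of_eq_empty Q(2)[OF that])
  qed
  have "\<exists>z. z \<in> Q a \<and> 0 < \<rho> a z (D a)" if a: "a \<in> A" for a
    using quasi_kappa_metric_meets[OF qk[OF a] D_reg Q(2)[OF a] _ Q_D[OF a]] Q(3) a by blast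
  then obtain z where z: "\<And>a. a \<in> A \<Longrightarrow> z a \<in> Q a \<and> 0 < \<rho> a (z a) (D a)" by metis
  define x where "x = restrict z A"
  have "x \<in> PiE A Q" using z by (auto simp: x_def)
  \<comment> \<open>The least of finitely many positive numbers meets the cardinality bound and all
    value bounds at once.\<close>
  define c where "c = Min (insert (1 / (real (card B) + 1)) ((\<lambda>a. \<rho> a (z a) (D a)) ` B))"
  have c: "c \<le> 1 / (real (card B) + 1)" "\<And>a. a \<in> B \<Longrightarrow> c \<le> \<rho> a (z a) (D a)"
    using B(1) by (auto simp: c_def)
  have "0 < c" unfolding c_def using B z by (subst Min_gr_iff) auto
  have "level x C c"
  proof (rule levelI[of B c D])
    show "c * (real (card B) + 1) \<le> 1" using c(1) by (simp add: field_simps)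
    show "c \<le> \<rho> a (x a) (D a)" if "a \<in> B" for a using c(2)[OF that] that B(2) by (auto simp: x_def)
    have "U \<subseteq> {y. \<exists>a\<in>B. y a \<in> D a}"
    proof (intro subsetI CollectI)
      fix y assume "y \<in> U"
      obtain R where R: "\<And>a. a \<in> A \<Longrightarrow> openin (X a) (R a)" "y \<in> PiE A R" "PiE A R \<subseteq> U"
        using U(1) \<open>y \<in> U\<close> by (rule openin_product_topology_boxE) blast
      \<comment> \<open>Disjoint boxes are disjoint in some coordinate \<open>a\<close>. There
        \<open>Q a\<close> is not the whole factor, so \<open>a\<close> is in \<open>B\<close>, and
        \<open>R a\<close> lies in the exterior of \<open>Q a\<close>.\<close>
      have "PiE A R \<inter> PiE A Q = {}" using R(3) Q(4) \<open>U \<subseteq> C\<close> W(3) by blast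
      then obtain a where a: "a \<in> A" "R a \<inter> Q a = {}" by (auto simp: PiE_Int PiE_eq_empty_iff)
      have "y a \<in> R a" using R(2) a(1) by auto
      moreover have "R a \<subseteq> topspace (X a)" using R(1) a(1) openin_subset by blast
      ultimately have "Q a \<noteq> topspace (X a)" using a(2) by blast
      then have "a \<in> B" using a(1) by (simp add: B_def)
      have "R a \<inter> X a closure_of Q a = {}"
        using a R(1) by (simp add: openin_Int_closure_of_eq_empty)
      then have "y a \<in> topspace (X a) - X a closure_of Q a"
        using \<open>y a \<in> R a\<close> \<open>R a \<subseteq> topspace (X a)\<close> by blast
      then have "y a \<in> D a"
        unfolding D_def using closure_of_subset[of "topspace (X a) - X a closure_of Q a" "X a"] by blast
      then show "\<exists>a\<in>B. y a \<in> D a" using \<open>a \<in> B\<close> by blast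
    qed
    then show "C \<subseteq> {y. \<exists>a\<in>B. y a \<in> D a}"
      unfolding U(2) using B D_reg regularly_closedin_closedin U(1)
      by (intro closure_of_subset_cylinder) blast+
  qed (use B D_reg in auto)
  then have "0 < prod_kappa x C" using level_le_prod_kappa[of x C c] \<open>0 < c\<close> by linarith
  then show ?thesis using \<open>x \<in> PiE A Q\<close> Q(4) by blast
qed

lemma prod_kappa_dense:
  assumes C: "regularly_closedin P C"
  shows "\<exists>V. openin (subtopology P (topspace P - C)) V \<and>
             subtopology P (topspace P - C) closure_of V = topspace P - C \<and>
             (\<forall>x\<in>topspace P. 0 < prod_kappa x C \<longleftrightarrow> x \<in> V)"
proof (intro exI conjI)
  let ?V = "{x \<in> topspace P. 0 < prod_kappa x C}"
  have V: "openin P ?V"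
    using prod_kappa_continuous[OF C] unfolding continuous_map_upper_lower_semicontinuous_lt by blast
  have VC: "?V \<subseteq> topspace P - C" using prod_kappa_notin by blast
  have "?V = ?V \<inter> (topspace P - C)" using VC by blast
  with V show "openin (subtopology P (topspace P - C)) ?V"
    unfolding openin_subtopology by (intro exI[of _ ?V] conjI)
  have op: "openin P (topspace P - C)"
    using C by (intro openin_diff openin_topspace regularly_closedin_closedin)
  have "topspace P - C \<subseteq> P closure_of ?V"
  proof
    fix x assume x: "x \<in> topspace P - C"
    have "\<exists>y. y \<in> ?V \<and> y \<in> T" if T: "x \<in> T" "openin P T" for T
    proof -
      have "\<exists>y\<in>T \<inter> (topspace P - C). 0 < prod_kappa y C"
        using x T op by (intro prod_kappa_meets[OF C]) (auto simp del: topspace_product_topology)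
      then show ?thesis by blast
    qed
    then show "x \<in> P closure_of ?V" using x unfolding in_closure_of by blast
  qed
  then show "subtopology P (topspace P - C) closure_of ?V = topspace P - C"
    using VC by (simp add: closure_of_subtopology Int_absorb1 Int_absorb2 del: topspace_product_topology)
  show "\<forall>x\<in>topspace P. 0 < prod_kappa x C \<longleftrightarrow> x \<in> ?V" by simp
qed

section \<open>Axiom K4\<close>

text \<open>One inequality is antitonicity. For the other the point is constant and the sets vary: a
  level common to all \<open>C j\<close> passes to the limit along an ultrafilter finer than the
  tails of \<open>r\<close>.\<close>

lemma prod_kappa_transfinite:
  assumes fam: "increasing_transfinite_family P J r C" and x: "x \<in> topspace P"
  shows "prod_kappa x (P closure_of (\<Union>j\<in>J. C j)) = (INF j\<in>J. prod_kappa x (C j))"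
proof (rule antisym)
  have J: "J \<noteq> {}" and wo: "well_order_on J r"
    and reg: "\<And>j. j \<in> J \<Longrightarrow> regularly_closedin P (C j)"
    and mono: "\<And>i j. (i, j) \<in> r \<Longrightarrow> C i \<subseteq> C j"
    using fam by (auto simp: increasing_transfinite_family_def)
  have r: "trans r" "refl_on J r" "total_on J r" "r \<subseteq> J \<times> J"
    using wo by (auto simp: order_on_defs)
  have sub: "(\<Union>j\<in>J. C j) \<subseteq> P closure_of (\<Union>j\<in>J. C j)"
    using reg regularly_closedin_subset by (intro closure_of_subset UN_least) blast
  show "prod_kappa x (P closure_of (\<Union>j\<in>J. C j)) \<le> (INF j\<in>J. prod_kappa x (C j))"
    using J sub by (intro cINF_greatest prod_kappa_antimono) auto
  show "(INF j\<in>J. prod_kappa x (C j)) \<le> prod_kappa x (P closure_of (\<Union>j\<in>J. C j))"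
  proof (rule le_prod_kappaI)
    fix c assume c: "0 < c" "c < (INF j\<in>J. prod_kappa x (C j))"
    have lev: "level x (C j) c" if "j \<in> J" for j
    proof -
      have "bdd_below ((\<lambda>j. prod_kappa x (C j)) ` J)"
        using prod_kappa_nonneg by (intro bdd_belowI2[of _ 0])
      then have "(INF j\<in>J. prod_kappa x (C j)) \<le> prod_kappa x (C j)" using that by (rule cINF_lower)
      then show ?thesis using c by (intro level_if_less_prod_kappa) auto
    qed
    obtain U where U: "\<And>j. j \<in> J \<Longrightarrow> openin P (U j) \<and> C j = P closure_of U j"
      using reg unfolding regularly_closedin_def by metis
    have clU: "P closure_of (\<Union>j\<in>J. C j) = P closure_of (\<Union>j\<in>J. U j)"
      using closure_of_UN_closure_of[of P U J] U by simp
    \<comment> \<open>The filter of tails; totality and transitivity of \<open>r\<close> make the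
      tails a filter base.\<close>
    define F where "F = (INF j\<in>J. principal {i. (j, i) \<in> r})"
    have F: "eventually R F \<longleftrightarrow> (\<exists>j\<in>J. \<forall>i. (j, i) \<in> r \<longrightarrow> R i)" for R
    proof -
      have "\<exists>k\<in>J. principal {i. (k, i) \<in> r} \<le> inf (principal {i. (a, i) \<in> r}) (principal {i. (b, i) \<in> r})"
        if ab: "a \<in> J" "b \<in> J" for a b
      proof -
        have "(a, b) \<in> r \<or> (b, a) \<in> r"
          using r(2,3) ab by (cases "a = b") (auto simp: total_on_def refl_on_def)
        then obtain k where "k \<in> J" "(a, k) \<in> r" "(b, k) \<in> r"
          using r(2) ab by (auto simp: refl_on_def)
        then show ?thesis using transD[OF r(1)] by (intro bexI[of _ k]) auto
      qed
      then show ?thesis unfolding F_def by (subst eventually_INF_base[OF J]) (auto simp: eventually_principal)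
    qed
    have "F \<noteq> bot"
    proof
      assume "F = bot"
      then have "eventually (\<lambda>_. False) F" by simp
      then show False unfolding F using r(2) by (auto simp: refl_on_def)
    qed
    then obtain G where G: "G \<le> F" "G \<noteq> bot"
      "\<And>R. eventually R G \<or> eventually (\<lambda>i. \<not> R i) G"
      using ultrafilter_exists by blast
    have "level x (P closure_of (\<Union>j\<in>J. U j)) c"
    proof (rule level_limit[OF G(3,2) c(1) x])
      show "eventually (\<lambda>i. x \<in> W) G" if "x \<in> W" for W using that by simp
      have "eventually (\<lambda>i. level x (C i) c) F"
        unfolding F using J lev r(4) by blast
      then show "eventually (\<lambda>i. level x (C i) c) G" by (rule filter_leD[OF G(1)])
      show "openin P (\<Union>j\<in>J. U j)" using U by blast
      fix p assume "p \<in> (\<Union>j\<in>J. U j)"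
      then obtain j where j: "j \<in> J" "p \<in> U j" by blast
      \<comment> \<open>The open set \<open>U j\<close> lies in every later \<open>C i\<close>, so
        it is the neighbourhood of \<open>p\<close> that the limit argument asks for.\<close>
      have "U j \<subseteq> C j" using U[OF j(1)] closure_of_subset openin_subset by metis
      then have "eventually (\<lambda>i. U j \<subseteq> C i) F" unfolding F using j(1) mono by blast
      then have "eventually (\<lambda>i. U j \<subseteq> C i) G" by (rule filter_leD[OF G(1)])
      then show "\<exists>W. openin P W \<and> p \<in> W \<and> eventually (\<lambda>i. W \<subseteq> C i) G" using U j by blast
    qed
    then show "level x (P closure_of (\<Union>j\<in>J. C j)) c" by (simp only: clU)
  qed
qed

lemma quasi_kappa_metric_prod_kappa: "quasi_kappa_metric P prod_kappa"
  unfolding quasi_kappa_metric_def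
proof (intro conjI allI impI ballI)
  show "prod_kappa x C' \<le> prod_kappa x C"
    if "regularly_closedin P C \<and> regularly_closedin P C' \<and> C \<subseteq> C'" for x C C'
    using that by (intro prod_kappa_antimono) blast
qed (rule prod_kappa_nonneg | erule prod_kappa_dense prod_kappa_continuous prod_kappa_transfinite, assumption?)+

section \<open>Axiom K5\<close>

lemma regular_quasi_kappa_metric_prod_kappa:
  assumes reg: "\<And>a. a \<in> A \<Longrightarrow> regular_quasi_kappa_metric (X a) (\<rho> a)"
  shows "regular_quasi_kappa_metric P prod_kappa"
  unfolding regular_quasi_kappa_metric_def
proof (intro conjI allI impI ballI quasi_kappa_metric_prod_kappa)
  fix C C' x
  assume "regularly_closedin P C \<and> regularly_closedin P C'" and x: "x \<in> topspace P"
  then have C': "regularly_closedin P C'" by blast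
  obtain U where U: "openin P U" "C' = P closure_of U"
    using C' by (auto simp: regularly_closedin_def)
  have C't: "C' \<subseteq> topspace P" using C' by (rule regularly_closedin_subset)
  have UC': "U \<subseteq> C'" using U closure_of_subset openin_subset by metis
  show "ennreal (prod_kappa x C) \<le> ennreal (prod_kappa x C') + sup_kappa prod_kappa C' C"
  proof (cases "sup_kappa prod_kappa C' C")
    case top
    then show ?thesis by simp
  next
    case (real s)
    have s: "prod_kappa y C \<le> s" if "y \<in> C'" for y
    proof -
      have "ennreal (prod_kappa y C) \<le> sup_kappa prod_kappa C' C"
        unfolding sup_kappa_def using that by (rule SUP_upper)
      then show ?thesis using real by (simp add: ennreal_le_iff)
    qed
    \<comment> \<open>For a finite supremum \<open>s\<close>, a witness for \<open>(x, C)\<close> at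
      level \<open>d + s\<close> is converted into one for \<open>(x, C')\<close> at level
      \<open>d\<close> with the same \<open>B\<close>.\<close>
    have "prod_kappa x C - s \<le> prod_kappa x C'"
    proof (rule le_prod_kappaI)
      fix d assume d: "0 < d" "d < prod_kappa x C - s"
      have "level x C (d + s)" using d real(1) by (intro level_if_less_prod_kappa) auto
      then obtain B D where B: "finite B" "B \<subseteq> A" "(d + s) * (real (card B) + 1) \<le> 1"
        "\<And>a. a \<in> B \<Longrightarrow> regularly_closedin (X a) (D a)"
        "\<And>a. a \<in> B \<Longrightarrow> d + s \<le> \<rho> a (x a) (D a)" "C \<subseteq> {y. \<exists>a\<in>B. y a \<in> D a}"
        by (rule levelE) blast
      define L where "L a = {z \<in> topspace (X a). \<rho> a z (D a) \<le> s}" for a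
      define E where "E a = X a closure_of (X a interior_of L a)" for a
      have E_reg: "regularly_closedin (X a) (E a)" for a
        unfolding E_def by (rule regularly_closedin_closure_of) simp
      have L_closed: "closedin (X a) (L a)" if "a \<in> B" for a
        using quasi_kappa_metric_continuous[OF qk B(4)[OF that]] that B(2)
        unfolding continuous_map_upper_lower_semicontinuous_le L_def by blast
      show "level x C' d"
      proof (rule levelI[of B d E])
        have "d * (real (card B) + 1) \<le> (d + s) * (real (card B) + 1)"
          using real(1) by (intro mult_right_mono) auto
        then show "d * (real (card B) + 1) \<le> 1" using B(3) by linarith
      next
        fix a assume a: "a \<in> B"
        then have aA: "a \<in> A" using B(2) by blast
        have xa: "x a \<in> topspace (X a)" using x aA by (rule topspace_component)
        \<comment> \<open>The value is at most \<open>s\<close> on \<open>E a\<close>, so K5 in the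
          factor bounds the loss from \<open>D a\<close> to \<open>E a\<close> by \<open>s\<close>:
          at least \<open>d\<close> remains of \<open>d + s\<close>.\<close>
        have "E a \<subseteq> L a"
          unfolding E_def by (intro closure_of_minimal interior_of_subset L_closed a)
        then have "sup_kappa (\<rho> a) (E a) (D a) \<le> ennreal s"
          unfolding sup_kappa_def by (intro SUP_least ennreal_leI) (auto simp: L_def)
        moreover have "ennreal (\<rho> a (x a) (D a)) \<le> ennreal (\<rho> a (x a) (E a)) + sup_kappa (\<rho> a) (E a) (D a)"
          using reg[OF aA] B(4)[OF a] E_reg xa unfolding regular_quasi_kappa_metric_def by blast
        ultimately have "ennreal (\<rho> a (x a) (D a)) \<le> ennreal (\<rho> a (x a) (E a)) + ennreal s"
          by (meson add_left_mono order_trans)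
        moreover have nn: "0 \<le> \<rho> a (x a) (E a)"
          using quasi_kappa_metric_nonneg[OF qk[OF aA] E_reg xa] .
        ultimately have "\<rho> a (x a) (D a) \<le> \<rho> a (x a) (E a) + s"
          using real(1) by (simp add: ennreal_le_iff flip: ennreal_plus)
        then show "d \<le> \<rho> a (x a) (E a)" using B(5)[OF a] by linarith
      next
        have "U \<subseteq> {y. \<exists>a\<in>B. y a \<in> E a}"
        proof (intro subsetI CollectI)
          fix y assume "y \<in> U"
          obtain R where R: "\<And>a. a \<in> A \<Longrightarrow> openin (X a) (R a)" "y \<in> PiE A R" "PiE A R \<subseteq> U"
            using U(1) \<open>y \<in> U\<close> by (rule openin_product_topology_boxE) blast
          \<comment> \<open>A point \<open>w\<close> of the box outside these cylinders has all
            values above \<open>s\<close>. With the same \<open>B\<close> and \<open>D\<close> this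
            gives a level above \<open>s\<close> for \<open>(w, C)\<close>, contradicting
            \<open>w \<in> C'\<close>.\<close>
          have "PiE A R \<subseteq> {w. \<exists>a\<in>B. w a \<in> L a}"
          proof (intro subsetI CollectI, rule ccontr)
            fix w assume w: "w \<in> PiE A R" and n: "\<not> (\<exists>a\<in>B. w a \<in> L a)"
            have wC: "w \<in> C'" using w R(3) UC' by blast
            then have wt: "w a \<in> topspace (X a)" if "a \<in> B" for a
              using that C't B(2) by (intro topspace_component) auto
            \<comment> \<open>Including \<open>d + s\<close> preserves the cardinality bound and
              keeps the minimum defined and above \<open>s\<close> for empty
              \<open>B\<close>.\<close>
            define e where "e = Min (insert (d + s) ((\<lambda>a. \<rho> a (w a) (D a)) ` B))"
            have e: "e \<le> d + s" "\<And>a. a \<in> B \<Longrightarrow> e \<le> \<rho> a (w a) (D a)" using B(1) by (auto simp: e_def)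
            have "s < e"
              unfolding e_def using B(1) n wt d(1) by (subst Min_gr_iff) (auto simp: L_def not_le)
            have "e * (real (card B) + 1) \<le> (d + s) * (real (card B) + 1)"
              using e(1) by (intro mult_right_mono) auto
            then have "e * (real (card B) + 1) \<le> 1" using B(3) by linarith
            then have "level w C e"
              using B e(2) by (intro levelI[of B e D]) auto
            then have "e \<le> prod_kappa w C" using \<open>s < e\<close> real(1) by (intro level_le_prod_kappa) auto
            then show False using s[OF wC] \<open>s < e\<close> by linarith
          qed
          then obtain a where a: "a \<in> B" "R a \<subseteq> L a"
            using box_subset_cylinder[of A R B L] R(2) B(2) by blast
          have "a \<in> A" using a(1) B(2) by blast
          then have "R a \<subseteq> X a interior_of L a" using R(1) a(2) by (simp add: interior_of_maximal)
          also have "\<dots> \<subseteq> E a"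
            unfolding E_def by (intro closure_of_subset interior_of_subset_topspace)
          finally show "\<exists>a\<in>B. y a \<in> E a" using a(1) R(2) \<open>a \<in> A\<close> by (auto simp: PiE_iff)
        qed
        then show "C' \<subseteq> {y. \<exists>a\<in>B. y a \<in> E a}"
          unfolding U(2) using B E_reg regularly_closedin_closedin U(1)
          by (intro closure_of_subset_cylinder) blast+
      qed (use B E_reg in auto)
    qed
    then have "ennreal (prod_kappa x C) \<le> ennreal (prod_kappa x C' + s)"
      by (intro ennreal_leI) simp
    also have "\<dots> = ennreal (prod_kappa x C') + ennreal s"
      using real(1) prod_kappa_nonneg by (intro ennreal_plus)
    finally show ?thesis using real(2) by simp
  qed
qed

end

section \<open>Tychonoff products and the product theorem\<close>

lemma tychonoff_space_product_topology:
  assumes "\<And>a. a \<in> A \<Longrightarrow> tychonoff_space (X a)"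
  shows "tychonoff_space (product_topology X A)"
  using assms
  by (simp add: tychonoff_space_def completely_regular_space_product_topology Hausdorff_space_product_topology)

theorem theorem2p5:
  fixes X :: "'i \<Rightarrow> 'a topology" and A :: "'i set"
  shows "((\<forall>\<alpha>\<in>A. quasi_kappa_metrizable_space (X \<alpha>)) \<longrightarrow>
            quasi_kappa_metrizable_space (product_topology X A)) \<and>
         ((\<forall>\<alpha>\<in>A. regularly_quasi_kappa_metrizable_space (X \<alpha>)) \<longrightarrow>
            regularly_quasi_kappa_metrizable_space (product_topology X A))"
proof (intro conjI impI)
  assume "\<forall>\<alpha>\<in>A. quasi_kappa_metrizable_space (X \<alpha>)"
  then have ty: "\<And>\<alpha>. \<alpha> \<in> A \<Longrightarrow> tychonoff_space (X \<alpha>)"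
    and "\<forall>\<alpha>\<in>A. \<exists>\<rho>. quasi_kappa_metric (X \<alpha>) \<rho>"
    by (auto simp: quasi_kappa_metrizable_space_def)
  then obtain \<rho> where "\<forall>\<alpha>\<in>A. quasi_kappa_metric (X \<alpha>) (\<rho> \<alpha>)" by metis
  then interpret quasi_kappa_product X A \<rho> by unfold_locales blast
  show "quasi_kappa_metrizable_space (product_topology X A)"
    unfolding quasi_kappa_metrizable_space_def
  proof (intro conjI exI)
    show "tychonoff_space (product_topology X A)" using ty by (rule tychonoff_space_product_topology)
    show "quasi_kappa_metric (product_topology X A) prod_kappa" by (rule quasi_kappa_metric_prod_kappa)
  qed
next
  assume "\<forall>\<alpha>\<in>A. regularly_quasi_kappa_metrizable_space (X \<alpha>)"
  then have ty: "\<And>\<alpha>. \<alpha> \<in> A \<Longrightarrow> tychonoff_space (X \<alpha>)"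
    and "\<forall>\<alpha>\<in>A. \<exists>\<rho>. regular_quasi_kappa_metric (X \<alpha>) \<rho>"
    by (auto simp: regularly_quasi_kappa_metrizable_space_def)
  then obtain \<rho> where \<rho>: "\<forall>\<alpha>\<in>A. regular_quasi_kappa_metric (X \<alpha>) (\<rho> \<alpha>)" by metis
  then interpret quasi_kappa_product X A \<rho>
    by unfold_locales (simp add: regular_quasi_kappa_metric_def)
  show "regularly_quasi_kappa_metrizable_space (product_topology X A)"
    unfolding regularly_quasi_kappa_metrizable_space_def
  proof (intro conjI exI)
    show "tychonoff_space (product_topology X A)" using ty by (rule tychonoff_space_product_topology)
    show "regular_quasi_kappa_metric (product_topology X A) prod_kappa"
      using \<rho> by (intro regular_quasi_kappa_metric_prod_kappa) blast
  qed
qed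

end
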